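(* Let $\alpha\in(0,1)$ and let $0=t_0<t_1<t_2<\cdots$ be time levels with $\tau_k=t_k-t_{k-1}$, $r_1:=0$, $r_k:=\tau_k/\tau_{k-1}$ ($k\ge2$), such that $r_k\ge R_*$ for all $k\ge2$. Then: (a) $A^{(n)}_{n-k-1}>A^{(n)}_{n-k}>0$ for $1\le k\le n-1$ ($n\ge2$); (b) $A^{(n-1)}_{n-1-k}>A^{(n)}_{n-k}$ for $1\le k\le n-1$ ($n\ge2$); (c) $A^{(n-1)}_{n-2-k}-A^{(n-1)}_{n-1-k}>A^{(n)}_{n-k-1}-A^{(n)}_{n-k}$ for $1\le k\le n-2$ ($n\ge3$). Moreover, for every real sequence $(v^k)_{k\ge0}$ and $n\ge2$, $$(\nabla_\tau v^n)\sum_{k=1}^n\hat a^{(n)}_{n-k}\nabla_\tau v^k\ge\frac12\Big[\sum_{j=1}^{n-1}\big(A^{(n)}_{n-j-1}-A^{(n)}_{n-j}\big)\Big(\sum_{\ell=j+1}^n\nabla_\tau v^\ell\Big)^2+A^{(n)}_{n-1}\Big(\sum_{\ell=1}^n\nabla_\tau v^\ell\Big)^2\Big]$$ $$\qquad-\frac12\Big[\sum_{j=1}^{n-2}\big(A^{(n-1)}_{n-j-2}-A^{(n-1)}_{n-1-j}\big)\Big(\sum_{\ell=j+1}^{n-1}\nabla_\tau v^\ell\Big)^2+A^{(n-1)}_{n-2}\Big(\sum_{\ell=1}^{n-1}\nabla_\tau v^\ell\Big)^2\Big].$$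
   Context: Write $\nabla_\tau v^k:=v^k-v^{k-1}$, $\omega_\beta(t):=t^{\beta-1}/\Gamma(\beta)$. For $1\le k\le n$: $a^{(n)}_{n-k}:=\frac1{\tau_k}\int_{t_{k-1}}^{t_k}\omega_{1-\alpha}(t_n-s)\,ds$, $\eta^{(n)}_{n-k}:=\frac{2}{\tau_k}\int_{t_{k-1}}^{t_k}\frac{s-t_{k-1/2}}{\tau_k}\omega_{1-\alpha}(t_n-s)\,ds$, $t_{k-1/2}=(t_k+t_{k-1})/2$. Kernels: $\hat a^{(1)}_0:=a^{(1)}_0$; for $n\ge2$: $\hat a^{(n)}_0:=\frac{1-\alpha}{2-\alpha}a^{(n)}_0+\frac{\eta^{(n)}_1}{r_n(1+r_n)}$, $\hat a^{(n)}_{n-k}:=a^{(n)}_{n-k}-\frac{\eta^{(n)}_{n-k}}{1+r_{k+1}}+\frac{\eta^{(n)}_{n-k+1}}{r_k(1+r_k)}$ ($2\le k\le n-1$), $\hat a^{(n)}_{n-1}:=a^{(n)}_{n-1}-\frac{\eta^{(n)}_{n-1}}{1+r_2}$. Auxiliary kernels: $A^{(n)}_0:=2\hat a^{(n)}_0$ and $A^{(n)}_{n-k}:=\hat a^{(n)}_{n-k}$ for $1\le k\le n-1$. $R_*=\frac19\sqrt[3]{\frac12(189-81\sqrt5)}+\frac13\sqrt[3]{\frac12(7+3\sqrt5)}-\frac13\approx0.4753$, the unique positive root of $3-\frac{1}{z^2(1+z)}=0$. *)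

theory Defs
  imports "HOL-Analysis.Analysis"
begin

definition omega :: "real \<Rightarrow> real \<Rightarrow> real" where
  "omega \<beta> x = x powr (\<beta> - 1) / Gamma \<beta>"

definition tau :: "(nat \<Rightarrow> real) \<Rightarrow> nat \<Rightarrow> real" where
  "tau t k = t k - t (k - 1)"

definition ratio :: "(nat \<Rightarrow> real) \<Rightarrow> nat \<Rightarrow> real" where
  "ratio t k = (if k \<le> 1 then 0 else tau t k / tau t (k - 1))"

(* Convention: every kernel is indexed by (n, k) and stands for the coefficient
   with subscript n-k, e.g.  ka t alpha n k  =  a^{(n)}_{n-k}. *)
definition ka :: "(nat \<Rightarrow> real) \<Rightarrow> real \<Rightarrow> nat \<Rightarrow> nat \<Rightarrow> real" where
  "ka t \<alpha> n k = (1 / tau t k) *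
     integral {t (k - 1)..t k} (\<lambda>s. omega (1 - \<alpha>) (t n - s))"

definition keta :: "(nat \<Rightarrow> real) \<Rightarrow> real \<Rightarrow> nat \<Rightarrow> nat \<Rightarrow> real" where
  "keta t \<alpha> n k = (2 / tau t k) *
     integral {t (k - 1)..t k}
       (\<lambda>s. (s - (t k + t (k - 1)) / 2) / tau t k * omega (1 - \<alpha>) (t n - s))"

definition khat :: "(nat \<Rightarrow> real) \<Rightarrow> real \<Rightarrow> nat \<Rightarrow> nat \<Rightarrow> real" where
  "khat t \<alpha> n k =
     (if n = 1 then ka t \<alpha> 1 1
      else if k = n then (1 - \<alpha>) / (2 - \<alpha>) * ka t \<alpha> n n
              + keta t \<alpha> n (n - 1) / (ratio t n * (1 + ratio t n))
      else if k = 1 then ka t \<alpha> n 1 - keta t \<alpha> n 1 / (1 + ratio t 2)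
      else ka t \<alpha> n k - keta t \<alpha> n k / (1 + ratio t (k + 1))
             + keta t \<alpha> n (k - 1) / (ratio t k * (1 + ratio t k)))"

definition kA :: "(nat \<Rightarrow> real) \<Rightarrow> real \<Rightarrow> nat \<Rightarrow> nat \<Rightarrow> real" where
  "kA t \<alpha> n k = (if k = n then 2 * khat t \<alpha> n k else khat t \<alpha> n k)"

definition R_star :: real where
  "R_star = root 3 ((189 - 81 * sqrt 5) / 2) / 9 + root 3 ((7 + 3 * sqrt 5) / 2) / 3 - 1 / 3"

definition nabla :: "(nat \<Rightarrow> real) \<Rightarrow> nat \<Rightarrow> real" where
  "nabla v k = v k - v (k - 1)"

end

theory Submission
  imports Defs
begin

text \<open>
  Put \<open>g\<^sub>n(s) = \<omega>\<^sub>1\<^sub>-\<^sub>\<alpha>(t\<^sub>n - s)\<close>. For \<open>k < n\<close> the auxiliary kernel with subscript \<open>n - k\<close> is a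
  linear functional \<open>K\<^sub>k\<close> of \<open>g\<^sub>n\<close> built from averages and skew moments over the mesh cells \<open>k\<close> and
  \<open>k - 1\<close>. If \<open>g\<close> is positive, increasing and convex, then
  \<open>g(t\<^sub>k\<^sub>-\<^sub>1) \<le> K\<^sub>k g \<le> g(t\<^sub>k)\<close>; the upper bound is where \<open>3 r\<^sup>2 (1 + r) \<ge> 1\<close>, i.e.
  \<open>r \<ge> R\<^sub>*\<close>, is needed. Hence \<open>K\<^sub>k g\<close> increases with \<open>k\<close>. For \<open>g = g\<^sub>n\<close> this is (a), and for
  \<open>g = g\<^sub>n - g\<^sub>n\<^sub>+\<^sub>1\<close>, which has the same properties, it is (b) and (c) away from the diagonal. The
  diagonal kernel equals \<open>(1 + \<alpha> / (2 - \<alpha>)) \<omega>\<^sub>1\<^sub>-\<^sub>\<alpha>(\<tau>\<^sub>n)\<close> plus a skew moment, and an integration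
  by parts shows that it exceeds the kernel of level \<open>n + 1\<close> on the same cell by more than
  \<open>g\<^sub>n(t\<^sub>n\<^sub>-\<^sub>1) - g\<^sub>n\<^sub>+\<^sub>1(t\<^sub>n\<^sub>-\<^sub>1)\<close>. The energy inequality follows from (b) and (c) after a summation
  by parts.
\<close>

section \<open>Averages and skew moments over one cell\<close>

definition avg :: "real \<Rightarrow> real \<Rightarrow> (real \<Rightarrow> real) \<Rightarrow> real" where
  "avg a b g = 1 / (b - a) * integral {a..b} g"

text \<open>The first moment about the midpoint, scaled so that for \<open>a < b\<close> constants
  give 0 and slope \<open>q\<close> gives \<open>q * (b - a) / 6\<close>.\<close>

definition skew :: "real \<Rightarrow> real \<Rightarrow> (real \<Rightarrow> real) \<Rightarrow> real" where
  "skew a b g = 2 / (b - a) * integral {a..b} (\<lambda>s. (s - (b + a) / 2) / (b - a) * g s)"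

lemma avg_diff:
  assumes "continuous_on {a..b} f" "continuous_on {a..b} g"
  shows "avg a b (\<lambda>s. f s - g s) = avg a b f - avg a b g"
proof -
  have "integral {a..b} (\<lambda>s. f s - g s) = integral {a..b} f - integral {a..b} g"
    by (intro Henstock_Kurzweil_Integration.integral_diff integrable_continuous_real assms)
  then show ?thesis by (simp add: avg_def diff_divide_distrib)
qed

lemma skew_diff:
  assumes "continuous_on {a..b} f" "continuous_on {a..b} g"
  shows "skew a b (\<lambda>s. f s - g s) = skew a b f - skew a b g"
\<comment> \<open>\<open>carry_diff\<close> also meets the degenerate cell from \<open>t 0\<close>
  to \<open>t 0\<close>; there both sides are 0 because division by zero gives 0.\<close>
proof (cases "a = b")
  case False
  let ?w = "\<lambda>s. (s - (b + a) / 2) / (b - a)"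
  have "integral {a..b} (\<lambda>s. ?w s * f s - ?w s * g s)
      = integral {a..b} (\<lambda>s. ?w s * f s) - integral {a..b} (\<lambda>s. ?w s * g s)"
    using False
    by (intro Henstock_Kurzweil_Integration.integral_diff integrable_continuous_real
        continuous_intros assms) auto
  then show ?thesis
    unfolding skew_def right_diff_distrib[of "?w _"] by (simp add: right_diff_distrib)
qed (simp add: skew_def)

lemma has_integral_midpoint_diff:
  fixes a b c :: real
  assumes "a \<le> b"
  shows "((\<lambda>s. (s - (b + a) / 2) * c) has_integral 0) {a..b}"
proof -
  have "((\<lambda>s. (s - (b + a) / 2) * c) has_integral
      (b - (b + a) / 2)\<^sup>2 / 2 * c - (a - (b + a) / 2)\<^sup>2 / 2 * c) {a..b}"
    by (rule fundamental_theorem_of_calculus[OF assms])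
      (auto intro!: derivative_eq_intros simp flip: has_real_derivative_iff_has_vector_derivative)
  moreover have "(b - (b + a) / 2)\<^sup>2 = (a - (b + a) / 2)\<^sup>2"
    by (simp add: power2_eq_square field_simps)
  ultimately show ?thesis by simp
qed

lemma has_integral_midpoint_square:
  fixes a b c :: real
  assumes "a \<le> b"
  shows "((\<lambda>s. (s - (b + a) / 2)\<^sup>2 * c) has_integral (b - a) ^ 3 / 12 * c) {a..b}"
proof -
  have "((\<lambda>s. (s - (b + a) / 2)\<^sup>2 * c) has_integral
      (b - (b + a) / 2) ^ 3 / 3 * c - (a - (b + a) / 2) ^ 3 / 3 * c) {a..b}"
    by (rule fundamental_theorem_of_calculus[OF assms])
      (auto intro!: derivative_eq_intros simp flip: has_real_derivative_iff_has_vector_derivative)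
  moreover have "(b - (b + a) / 2) ^ 3 / 3 * c - (a - (b + a) / 2) ^ 3 / 3 * c
      = (b - a) ^ 3 / 12 * c"
    by (simp add: power3_eq_cube field_simps)
  ultimately show ?thesis by metis
qed

lemma skew_eq_integral:
  "skew a b g = 2 / (b - a)\<^sup>2 * integral {a..b} (\<lambda>s. (s - (b + a) / 2) * g s)"
proof -
  have "(\<lambda>s. (s - (b + a) / 2) / (b - a) * g s) = (\<lambda>s. 1 / (b - a) * ((s - (b + a) / 2) * g s))"
    by auto
  then show ?thesis by (simp add: skew_def power2_eq_square)
qed

text \<open>\<open>MVT2\<close> wants ordered endpoints; this form serves points on either side of
  the midpoint.\<close>

lemma mvt_between:
  fixes g :: "real \<Rightarrow> real"
  assumes "\<And>s. s \<in> {a..b} \<Longrightarrow> (g has_real_derivative g' s) (at s)"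
    and "x \<in> {a..b}" "y \<in> {a..b}"
  shows "\<exists>z \<in> {a..b}. g x - g y = (x - y) * g' z"
proof (cases x y rule: linorder_cases)
  case less
  then obtain z where "z > x" "z < y" "g y - g x = (y - x) * g' z"
    using MVT2[of x y g g'] assms by auto
  then show ?thesis using assms by (intro bexI[of _ z]) (auto simp: algebra_simps)
next
  case equal
  then show ?thesis using assms by auto
next
  case greater
  then obtain z where "z > y" "z < x" "g x - g y = (x - y) * g' z"
    using MVT2[of y x g g'] assms by auto
  then show ?thesis using assms by (intro bexI[of _ z]) auto
qed

text \<open>The midpoint weight annihilates the value \<open>g c\<close>. The mean value theorem
  leaves a slope times the square of \<open>s - c\<close>, so the sign of \<open>s - c\<close> does
  not matter.\<close>

lemma skew_bounds:
  assumes "a < b"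
    and deriv: "\<And>s. s \<in> {a..b} \<Longrightarrow> (g has_real_derivative g' s) (at s)"
    and bounds: "\<And>s. s \<in> {a..b} \<Longrightarrow> m \<le> g' s \<and> g' s \<le> M"
  shows "m * (b - a) / 6 \<le> skew a b g" "skew a b g \<le> M * (b - a) / 6"
proof -
  define c where "c = (b + a) / 2"
  have c: "c \<in> {a..b}" using assms(1) by (auto simp: c_def)
  have cont: "continuous_on {a..b} g"
    using deriv by (meson DERIV_continuous_on has_field_derivative_at_within)
  have pw: "(s - c) * g c + (s - c)\<^sup>2 * m \<le> (s - c) * g s
      \<and> (s - c) * g s \<le> (s - c) * g c + (s - c)\<^sup>2 * M" if s: "s \<in> {a..b}" for s
  proof -
    obtain z where z: "z \<in> {a..b}" "g s - g c = (s - c) * g' z"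
      using mvt_between[of a b g g', OF deriv s c] by blast
    have "(s - c) * g s = (s - c) * g c + (s - c) * (g s - g c)"
      by (simp add: algebra_simps)
    also have "\<dots> = (s - c) * g c + (s - c)\<^sup>2 * g' z"
      by (simp add: z(2) power2_eq_square)
    finally show ?thesis
      using bounds[OF z(1)] by (simp add: mult_left_mono)
  qed
  let ?I = "integral {a..b} (\<lambda>s. (s - c) * g s)"
  have I: "((\<lambda>s. (s - c) * g s) has_integral ?I) {a..b}"
    by (intro integrable_integral integrable_continuous_real continuous_intros cont)
  have Q: "((\<lambda>s. (s - c) * g c + (s - c)\<^sup>2 * q) has_integral (b - a) ^ 3 / 12 * q) {a..b}" for q
    using has_integral_add[OF has_integral_midpoint_diff[of a b "g c"]
        has_integral_midpoint_square[of a b q]] assms(1) by (simp add: c_def)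
  have "(b - a) ^ 3 / 12 * m \<le> ?I" "?I \<le> (b - a) ^ 3 / 12 * M"
    using has_integral_le[OF Q I] has_integral_le[OF I Q] pw by blast+
  then have "2 / (b - a)\<^sup>2 * ((b - a) ^ 3 / 12 * m) \<le> skew a b g"
    "skew a b g \<le> 2 / (b - a)\<^sup>2 * ((b - a) ^ 3 / 12 * M)"
    unfolding skew_eq_integral c_def[symmetric] by (intro mult_left_mono; simp)+
  moreover have "2 / (b - a)\<^sup>2 * ((b - a) ^ 3 / 12 * q) = q * (b - a) / 6" for q
    using assms(1) by (simp add: power2_eq_square power3_eq_cube)
  ultimately show "m * (b - a) / 6 \<le> skew a b g" "skew a b g \<le> M * (b - a) / 6"
    by (simp_all only:)
qed

text \<open>The graph lies below the line of slope \<open>m\<close> through its right endpoint, and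
  the bound is the average of that line.\<close>

lemma avg_le_endpoint:
  assumes "a < b"
    and deriv: "\<And>s. s \<in> {a..b} \<Longrightarrow> (g has_real_derivative g' s) (at s)"
    and bound: "\<And>s. s \<in> {a..b} \<Longrightarrow> m \<le> g' s"
  shows "avg a b g \<le> g b - m * (b - a) / 2"
proof -
  have cont: "continuous_on {a..b} g"
    using deriv by (meson DERIV_continuous_on has_field_derivative_at_within)
  have pw: "g s \<le> g b - m * (b - s)" if s: "s \<in> {a..b}" for s
  proof -
    obtain z where z: "z \<in> {a..b}" "g b - g s = (b - s) * g' z"
      using mvt_between[of a b g g' b s, OF deriv _ s] assms(1) by auto
    then have "(b - s) * m \<le> g b - g s"
      using bound[OF z(1)] s by (auto intro!: mult_left_mono)
    then show ?thesis by (simp add: algebra_simps)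
  qed
  have "((\<lambda>s. g b - m * (b - s)) has_integral
      (g b * b + m * (b - b)\<^sup>2 / 2) - (g b * a + m * (b - a)\<^sup>2 / 2)) {a..b}"
    using assms(1)
    by (intro fundamental_theorem_of_calculus)
      (auto intro!: derivative_eq_intros simp: field_simps
        simp flip: has_real_derivative_iff_has_vector_derivative)
  from has_integral_le[OF integrable_integral[OF integrable_continuous_real[OF cont]] this pw]
  have "integral {a..b} g \<le> g b * (b - a) - m * (b - a)\<^sup>2 / 2"
    by (simp add: algebra_simps)
  then have "1 / (b - a) * integral {a..b} g \<le> 1 / (b - a) * (g b * (b - a) - m * (b - a)\<^sup>2 / 2)"
    using assms(1) by (intro mult_left_mono) auto
  also have "\<dots> = g b - m * (b - a) / 2"
    using assms(1) by (simp add: power2_eq_square field_simps)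
  finally show ?thesis by (simp add: avg_def)
qed

text \<open>Both functionals merge into one integral whose weight runs linearly from
  \<open>1 + \<theta>\<close> to \<open>1 - \<theta>\<close>, so its sign can be read off.\<close>

lemma avg_minus_skew_eq:
  assumes "a < b" "continuous_on {a..b} g"
  shows "avg a b g - \<theta> * skew a b g
    = integral {a..b} (\<lambda>s. (1 - \<theta> / (b - a) * (2 * s - a - b)) * g s) / (b - a)"
proof -
  let ?w = "\<lambda>s. (s - (b + a) / 2)"
  let ?J = "integral {a..b} (\<lambda>s. ?w s * g s)"
  have "(\<lambda>s. (1 - \<theta> / (b - a) * (2 * s - a - b)) * g s)
      = (\<lambda>s. g s - (2 * \<theta> / (b - a)) * (?w s * g s))"
    using assms(1) by (auto simp: field_simps)
  then have "integral {a..b} (\<lambda>s. (1 - \<theta> / (b - a) * (2 * s - a - b)) * g s)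
     = integral {a..b} (\<lambda>s. g s - (2 * \<theta> / (b - a)) * (?w s * g s))"
    by simp
  also have "\<dots> = integral {a..b} g - integral {a..b} (\<lambda>s. (2 * \<theta> / (b - a)) * (?w s * g s))"
    by (intro Henstock_Kurzweil_Integration.integral_diff integrable_continuous_real
        continuous_intros assms)
  also have "\<dots> = integral {a..b} g - (2 * \<theta> / (b - a)) * ?J"
    by (simp only: integral_mult_right)
  finally show ?thesis
    unfolding avg_def skew_eq_integral
    by (simp only: diff_divide_distrib) (simp add: power2_eq_square)
qed

text \<open>For \<theta> between 0 and 1 the weight is nonnegative with mean 1, so replacing
  \<open>g\<close> by \<open>g a\<close> only lowers the integral.\<close>

lemma avg_minus_skew_ge:
  assumes "a < b" "continuous_on {a..b} g" "mono_on {a..b} g" "0 \<le> \<theta>" "\<theta> \<le> 1"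
  shows "g a \<le> avg a b g - \<theta> * skew a b g"
proof -
  define \<kappa> where "\<kappa> = \<theta> / (b - a)"
  let ?w = "\<lambda>s. 1 - \<kappa> * (2 * s - a - b)"
  have w: "0 \<le> ?w s" if "s \<in> {a..b}" for s
  proof -
    have "\<kappa> * (2 * s - a - b) \<le> \<kappa> * (b - a)"
      using that assms by (intro mult_left_mono) (auto simp: \<kappa>_def)
    also have "\<dots> = \<theta>" using assms(1) by (simp add: \<kappa>_def)
    finally show ?thesis using assms(5) by simp
  qed
  \<comment> \<open>The antiderivative of the weight is
    \<open>s - \<kappa> * ((s - a) * (s - b))\<close>, whose second term vanishes at both
    ends.\<close>
  have "((\<lambda>s. ?w s * g a) has_integral
      (b - \<kappa> * ((b - a) * (b - b))) * g a - (a - \<kappa> * ((a - a) * (a - b))) * g a) {a..b}"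
    using assms(1)
    by (intro fundamental_theorem_of_calculus)
      (auto intro!: derivative_eq_intros simp: algebra_simps
        simp flip: has_real_derivative_iff_has_vector_derivative)
  moreover have "((\<lambda>s. ?w s * g s) has_integral integral {a..b} (\<lambda>s. ?w s * g s)) {a..b}"
    by (intro integrable_integral integrable_continuous_real continuous_intros assms)
  moreover have "?w s * g a \<le> ?w s * g s" if "s \<in> {a..b}" for s
    using that w[OF that] assms(1) by (intro mult_left_mono mono_onD[OF assms(3)]) auto
  ultimately have "(b - \<kappa> * ((b - a) * (b - b))) * g a - (a - \<kappa> * ((a - a) * (a - b))) * g a
      \<le> integral {a..b} (\<lambda>s. ?w s * g s)"
    by (rule has_integral_le)
  then have "(b - a) * g a \<le> integral {a..b} (\<lambda>s. ?w s * g s)"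
    by (simp add: algebra_simps)
  then show ?thesis
    using assms(1) by (simp add: avg_minus_skew_eq[OF assms(1,2)] \<kappa>_def pos_le_divide_eq mult.commute)
qed

section \<open>The threshold \<open>R_star\<close>\<close>

text \<open>Cardano's formula: with \<open>z = (y - 1) / 3\<close> the equation
  \<open>3 z^2 (1 + z) = 1\<close> becomes \<open>y^3 = 3 y + 7\<close>, solved by
  \<open>y = p + q\<close> where \<open>p q = 1\<close> and \<open>p^3 + q^3 = 7\<close>.\<close>

lemma R_star_props: "0 < R_star" "3 * R_star\<^sup>2 * (1 + R_star) = 1"
proof -
  define p q where "p = root 3 ((7 + 3 * sqrt 5) / 2)" and "q = root 3 ((7 - 3 * sqrt 5) / 2)"
  have "3 * sqrt 5 = sqrt 45"
    by (rule real_sqrt_unique[symmetric]) (auto simp: power2_eq_square)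
  also have "\<dots> < sqrt 49" by (subst real_sqrt_less_iff) simp
  also have "sqrt 49 = 7" by (rule real_sqrt_unique) auto
  finally have lt: "3 * sqrt 5 < 7" .
  have pos: "0 < p" "0 < q" using lt by (simp_all add: p_def q_def add_pos_pos)
  have "root 3 ((189 - 81 * sqrt 5) / 2) = root 3 (3 ^ 3 * ((7 - 3 * sqrt 5) / 2))"
    by (simp add: field_simps)
  also have "\<dots> = 3 * q" by (subst real_root_mult) (simp add: q_def real_root_power_cancel)
  finally have R: "R_star = (p + q - 1) / 3" by (simp add: R_star_def p_def field_simps)
  have cubes: "p ^ 3 = (7 + 3 * sqrt 5) / 2" "q ^ 3 = (7 - 3 * sqrt 5) / 2"
    using lt by (simp_all add: p_def q_def)
  have "p * q = root 3 ((7 + 3 * sqrt 5) / 2 * ((7 - 3 * sqrt 5) / 2))"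
    by (simp only: p_def q_def real_root_mult)
  also have "(7 + 3 * sqrt 5) / 2 * ((7 - 3 * sqrt 5) / 2) = 1"
    by (simp add: field_simps)
  finally have pq: "p * q = 1" by simp
  \<comment> \<open>From \<open>p q = 1\<close> follows \<open>p + q \<ge> 2\<close>, hence
    \<open>R_star \<ge> 1 / 3\<close>.\<close>
  have "(p + q)\<^sup>2 = (p - q)\<^sup>2 + 2\<^sup>2"
    using pq by (simp add: power2_eq_square algebra_simps)
  then have "2\<^sup>2 \<le> (p + q)\<^sup>2" by simp
  then have "2 \<le> p + q" using pos by (meson add_pos_pos less_imp_le power2_le_imp_le)
  then show "0 < R_star" by (simp add: R)
  have "(p + q) ^ 3 = p ^ 3 + q ^ 3 + 3 * (p * q) * (p + q)"
    by (simp add: power3_eq_cube algebra_simps)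
  then have "(p + q) ^ 3 = 7 + 3 * (p + q)" by (simp add: cubes pq field_simps)
  then show "3 * R_star\<^sup>2 * (1 + R_star) = 1"
    unfolding R by (simp add: power2_eq_square power3_eq_cube field_simps)
qed

text \<open>The expression \<open>3 r^2 (1 + r)\<close> increases for positive \<open>r\<close>; the
  divided form bounds the coefficient in \<open>carry\<close>.\<close>

lemma ge_R_star_props:
  assumes "R_star \<le> r"
  shows "0 < r" "1 / (r * (1 + r)) \<le> 3 * r"
proof -
  show r: "0 < r" using assms R_star_props by linarith
  have "1 = 3 * R_star\<^sup>2 * (1 + R_star)" using R_star_props by simp
  also have "\<dots> \<le> 3 * r\<^sup>2 * (1 + r)"
    using assms R_star_props(1) by (intro mult_mono power_mono) auto
  finally show "1 / (r * (1 + r)) \<le> 3 * r"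
    using r by (subst pos_divide_le_eq) (auto simp: algebra_simps power2_eq_square intro: add_pos_pos)
qed

section \<open>The singular kernel on the diagonal cell\<close>

lemma has_integral_reflected_powr:
  fixes a b p :: real
  assumes "a \<le> b" "-1 < p"
  shows "((\<lambda>s. (b - s) powr p) has_integral (b - a) powr (p + 1) / (p + 1)) {a..b}"
proof -
  have "((\<lambda>s. (b - s) powr p) has_integral
      (- ((b - b) powr (p + 1) / (p + 1)) - (- ((b - a) powr (p + 1) / (p + 1))))) {a..b}"
  \<comment> \<open>For negative \<open>p\<close> the integrand is unbounded near \<open>b\<close>,
    so the derivative is taken only inside the interval and the antiderivative is continuous up to
    \<open>b\<close>.\<close>
  proof (rule fundamental_theorem_of_calculus_interior[OF assms(1)])
    show "continuous_on {a..b} (\<lambda>s. - ((b - s) powr (p + 1) / (p + 1)))"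
      using assms by (intro continuous_intros continuous_on_powr') auto
    show "((\<lambda>s. - ((b - s) powr (p + 1) / (p + 1))) has_vector_derivative (b - s) powr p) (at s)"
      if "s \<in> {a<..<b}" for s
      using that assms
      by (auto intro!: derivative_eq_intros simp flip: has_real_derivative_iff_has_vector_derivative)
  qed
  then show ?thesis by simp
qed

lemma omega_pos: "\<beta> > 0 \<Longrightarrow> x > 0 \<Longrightarrow> 0 < omega \<beta> x"
  by (simp add: omega_def Gamma_real_pos)

lemma avg_omega_diag:
  assumes "0 < \<alpha>" "\<alpha> < 1" "a < b"
  shows "avg a b (\<lambda>s. omega (1 - \<alpha>) (b - s)) = omega (1 - \<alpha>) (b - a) / (1 - \<alpha>)"
proof -
  have "((\<lambda>s. (b - s) powr (- \<alpha>) / Gamma (1 - \<alpha>)) has_integral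
      (b - a) powr (- \<alpha> + 1) / (- \<alpha> + 1) / Gamma (1 - \<alpha>)) {a..b}"
    using assms by (intro has_integral_divide has_integral_reflected_powr) auto
  then have "integral {a..b} (\<lambda>s. omega (1 - \<alpha>) (b - s))
      = (b - a) powr (- \<alpha> + 1) / (- \<alpha> + 1) / Gamma (1 - \<alpha>)"
    by (simp add: omega_def has_integral_iff)
  moreover have "(b - a) powr (- \<alpha> + 1) = (b - a) * (b - a) powr (- \<alpha>)"
    using assms powr_add[of "b - a" "- \<alpha>" 1] by (simp add: mult.commute)
  ultimately show ?thesis
    using assms by (simp add: avg_def omega_def)
qed

text \<open>
  The boundary term of \<open>(s - b) (x - s)\<^sup>1\<^sup>-\<^sup>\<alpha>\<close> produces the value at \<open>a\<close>, and what
  is left of the integrand is at most \<open>\<alpha> (b - s)\<^sup>1\<^sup>-\<^sup>\<alpha>\<close>.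
\<close>

lemma avg_minus_skew_omega_less:
  assumes "0 < \<alpha>" "\<alpha> < 1" "a < b" "b < x"
  defines "g \<equiv> \<lambda>s. omega (1 - \<alpha>) (x - s)"
  shows "avg a b g - skew a b g / (1 + (x - b) / (b - a))
      < g a + \<alpha> / (2 - \<alpha>) * omega (1 - \<alpha>) (b - a)"
proof -
  define G where "G = Gamma (1 - \<alpha>)"
  have G: "0 < G" using assms by (simp add: G_def Gamma_real_pos)
  define C where "C = 1 / ((x - a) * G)"
  have C: "0 < C" using assms G by (simp add: C_def)
  define \<Phi> where "\<Phi> = (\<lambda>s. C * ((s - b) * (x - s) powr (1 - \<alpha>)))"
  define \<Phi>' where "\<Phi>' = (\<lambda>s. C * ((x - s) powr (1 - \<alpha>) + (1 - \<alpha>) * (b - s) * (x - s) powr (- \<alpha>)))"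
  have cont: "continuous_on {a..b} g"
    unfolding g_def omega_def using G assms
    by (intro continuous_intros) (auto simp flip: G_def)
  have "(\<Phi> has_real_derivative \<Phi>' s) (at s)" if "s \<in> {a..b}" for s
    unfolding \<Phi>_def \<Phi>'_def using that assms
    by (auto intro!: derivative_eq_intros simp: algebra_simps)
  then have "(\<Phi>' has_integral \<Phi> b - \<Phi> a) {a..b}"
    using assms by (intro fundamental_theorem_of_calculus)
      (auto intro: has_field_derivative_at_within
        simp flip: has_real_derivative_iff_has_vector_derivative)
  then have upper: "((\<lambda>s. \<Phi>' s + C * \<alpha> * (b - s) powr (1 - \<alpha>)) has_integral
      \<Phi> b - \<Phi> a + C * \<alpha> * ((b - a) powr (1 - \<alpha> + 1) / (1 - \<alpha> + 1))) {a..b}"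
    using assms by (intro has_integral_add has_integral_mult_right has_integral_reflected_powr) auto
  \<comment> \<open>The weight of \<open>avg_minus_skew_eq\<close> for
    \<open>\<theta> = (b - a) / (x - a)\<close>, the reciprocal of
    \<open>1 + (x - b) / (b - a)\<close>.\<close>
  let ?w = "\<lambda>s. 1 - 1 / (x - a) * (2 * s - a - b)"
  have pw: "?w s * g s \<le> \<Phi>' s + C * \<alpha> * (b - s) powr (1 - \<alpha>)" if s: "s \<in> {a..b}" for s
  proof -
    have xs: "(x - s) powr (1 - \<alpha>) = (x - s) * (x - s) powr (- \<alpha>)"
      using s assms by (simp add: powr_diff powr_minus field_simps)
    have "?w s * g s = C * ((x + b - 2 * s) * (x - s) powr (- \<alpha>))"
      using assms G by (simp add: g_def omega_def C_def G_def[symmetric] field_simps)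
    \<comment> \<open>Split \<open>x + b - 2 * s\<close> as \<open>(x - s) + (b - s)\<close>, and
      the coefficient 1 of the second part as \<open>(1 - \<alpha>) + \<alpha>\<close>.\<close>
    also have "\<dots> = \<Phi>' s + C * \<alpha> * ((b - s) * (x - s) powr (- \<alpha>))"
      unfolding \<Phi>'_def xs by (simp add: algebra_simps)
    also have "(b - s) * (x - s) powr (- \<alpha>) \<le> (b - s) powr (1 - \<alpha>)"
    \<comment> \<open>At \<open>s = b\<close> the convention \<open>0 powr _ = 0\<close> spoils the
      comparison of powers, but both sides are 0.\<close>
    proof (cases "s = b")
      case False
      then have "(x - s) powr (- \<alpha>) \<le> (b - s) powr (- \<alpha>)"
        using s assms by (intro powr_mono2') auto
      then have "(b - s) * (x - s) powr (- \<alpha>) \<le> (b - s) * (b - s) powr (- \<alpha>)"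
        using s by (intro mult_left_mono) auto
      also have "\<dots> = (b - s) powr (1 - \<alpha>)"
        using s False by (simp add: powr_diff powr_minus field_simps)
      finally show ?thesis .
    qed simp
    finally show ?thesis using C assms by (simp add: mult_left_mono)
  qed
  have "((\<lambda>s. ?w s * g s) has_integral integral {a..b} (\<lambda>s. ?w s * g s)) {a..b}"
    using assms by (intro integrable_integral integrable_continuous_real continuous_intros cont) auto
  from has_integral_le[OF this upper pw]
  have "integral {a..b} (\<lambda>s. ?w s * g s)
      \<le> \<Phi> b - \<Phi> a + C * \<alpha> * ((b - a) powr (1 - \<alpha> + 1) / (1 - \<alpha> + 1))" .
  also have "\<Phi> b - \<Phi> a = (b - a) * g a"
    using assms G by (simp add: \<Phi>_def C_def g_def omega_def G_def[symmetric] powr_diff powr_minus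
        field_simps)
  also have "C * \<alpha> * ((b - a) powr (1 - \<alpha> + 1) / (1 - \<alpha> + 1))
      = (b - a) * ((b - a) / (x - a) * (\<alpha> / (2 - \<alpha>) * omega (1 - \<alpha>) (b - a)))"
  proof -
    have "(b - a) powr (1 - \<alpha> + 1) = (b - a) * (b - a) * (b - a) powr (- \<alpha>)"
      using assms by (simp add: powr_diff powr_add powr_minus power2_eq_square field_simps)
    then show ?thesis using assms G by (simp add: C_def omega_def G_def[symmetric] ac_simps)
  qed
  also have "(b - a) * ((b - a) / (x - a) * (\<alpha> / (2 - \<alpha>) * omega (1 - \<alpha>) (b - a)))
      < (b - a) * (1 * (\<alpha> / (2 - \<alpha>) * omega (1 - \<alpha>) (b - a)))"
    using assms omega_pos[of "1 - \<alpha>" "b - a"]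
    by (intro mult_strict_left_mono mult_strict_right_mono) auto
  finally have less: "integral {a..b} (\<lambda>s. ?w s * g s)
      < (g a + \<alpha> / (2 - \<alpha>) * omega (1 - \<alpha>) (b - a)) * (b - a)"
    by (simp add: algebra_simps)
  define \<theta> where "\<theta> = (b - a) / (x - a)"
  have \<theta>: "\<theta> / (b - a) = 1 / (x - a)" "1 + (x - b) / (b - a) = 1 / \<theta>"
    using assms(3) by (simp add: \<theta>_def, simp add: \<theta>_def diff_divide_distrib[symmetric] add_divide_eq_iff)
  have "avg a b g - \<theta> * skew a b g = integral {a..b} (\<lambda>s. ?w s * g s) / (b - a)"
    by (simp only: avg_minus_skew_eq[OF assms(3) cont] \<theta>(1))
  also have "\<dots> < g a + \<alpha> / (2 - \<alpha>) * omega (1 - \<alpha>) (b - a)"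
    using less assms(3) by (simp only: pos_divide_less_eq diff_gt_0_iff_gt)
  finally show ?thesis by (simp add: \<theta>(2) mult.commute)
qed

section \<open>Positive, increasing, convex functions\<close>

text \<open>Convexity is encoded as monotonicity of \<open>g'\<close>. Derivatives are two-sided
  even at \<open>c\<close>, so a function singular at \<open>x\<close> qualifies only for
  \<open>c < x\<close>.\<close>

definition admissible :: "real \<Rightarrow> (real \<Rightarrow> real) \<Rightarrow> bool" where
  "admissible c g \<longleftrightarrow> (\<exists>g'. (\<forall>s\<in>{0..c}. 0 < g s \<and> 0 < g' s \<and> (g has_real_derivative g' s) (at s))
      \<and> mono_on {0..c} g')"

lemma admissible_antimono: "admissible c g \<Longrightarrow> b \<le> c \<Longrightarrow> admissible b g"
  unfolding admissible_def by (force intro: mono_on_subset)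

lemma admissible_imp_continuous_on: "admissible c g \<Longrightarrow> continuous_on {0..c} g"
  unfolding admissible_def by (meson DERIV_continuous_on has_field_derivative_at_within)

lemma admissible_imp_mono_on:
  assumes "admissible c g"
  shows "mono_on {0..c} g"
proof (rule mono_onI)
  fix x y assume xy: "x \<in> {0..c}" "y \<in> {0..c}" "x \<le> y"
  obtain g' where "\<forall>s\<in>{0..c}. 0 < g s \<and> 0 < g' s \<and> (g has_real_derivative g' s) (at s)"
    using assms unfolding admissible_def by blast
  then show "g x \<le> g y"
    using xy by (intro DERIV_nonneg_imp_nondecreasing[OF xy(3)]) (force intro: less_imp_le)
qed

lemma omega_has_derivative:
  assumes "\<alpha> < 1" "s < x"
  shows "((\<lambda>s. omega (1 - \<alpha>) (x - s)) has_real_derivative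
    \<alpha> * (x - s) powr (- \<alpha> - 1) / Gamma (1 - \<alpha>)) (at s)"
proof -
  have "Gamma (1 - \<alpha>) \<noteq> 0" using assms Gamma_real_pos[of "1 - \<alpha>"] by linarith
  then show ?thesis unfolding omega_def using assms by (auto intro!: derivative_eq_intros)
qed

lemma admissible_omega:
  assumes "0 < \<alpha>" "\<alpha> < 1" "c < x"
  shows "admissible c (\<lambda>s. omega (1 - \<alpha>) (x - s))"
  unfolding admissible_def
proof (intro exI conjI ballI)
  let ?g' = "\<lambda>s. \<alpha> * (x - s) powr (- \<alpha> - 1) / Gamma (1 - \<alpha>)"
  have G: "0 < Gamma (1 - \<alpha>)" using assms by (simp add: Gamma_real_pos)
  show "mono_on {0..c} ?g'"
    using assms G by (intro mono_onI divide_right_mono mult_left_mono powr_mono2') auto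
  fix s assume s: "s \<in> {0..c}"
  show "(((\<lambda>s. omega (1 - \<alpha>) (x - s)) has_real_derivative ?g' s) (at s))"
    using s assms by (intro omega_has_derivative) auto
  show "0 < omega (1 - \<alpha>) (x - s)" "0 < ?g' s"
    using s assms G by (auto intro!: omega_pos)
qed

text \<open>Convexity of a negative power. With exponent \<open>- \<alpha> - 1\<close> it makes a
  difference of two levels convex.\<close>

lemma powr_increment_mono:
  fixes p x y c :: real
  assumes "p < 0" "0 < x" "x \<le> y" "0 \<le> c"
  shows "y powr p - (y + c) powr p \<le> x powr p - (x + c) powr p"
proof (rule DERIV_nonpos_imp_nonincreasing[OF assms(3)])
  fix z assume z: "x \<le> z" "z \<le> y"
  have "((\<lambda>z. z powr p - (z + c) powr p) has_real_derivative
      p * (z powr (p - 1) - (z + c) powr (p - 1))) (at z)"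
    using z assms by (auto intro!: derivative_eq_intros simp: algebra_simps)
  moreover have "p * (z powr (p - 1) - (z + c) powr (p - 1)) \<le> 0"
    using z assms powr_mono2'[of "p - 1" z "z + c"] by (intro mult_nonpos_nonneg) auto
  ultimately show "\<exists>D. ((\<lambda>z. z powr p - (z + c) powr p) has_real_derivative D) (at z) \<and> D \<le> 0"
    by blast
qed

lemma admissible_omega_diff:
  assumes "0 < \<alpha>" "\<alpha> < 1" "c < x" "x < y"
  shows "admissible c (\<lambda>s. omega (1 - \<alpha>) (x - s) - omega (1 - \<alpha>) (y - s))"
  unfolding admissible_def
proof (intro exI conjI ballI)
  let ?g' = "\<lambda>s. \<alpha> * (x - s) powr (- \<alpha> - 1) / Gamma (1 - \<alpha>)
    - \<alpha> * (y - s) powr (- \<alpha> - 1) / Gamma (1 - \<alpha>)"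
  have G: "0 < Gamma (1 - \<alpha>)" using assms by (simp add: Gamma_real_pos)
  have g': "?g' s = \<alpha> / Gamma (1 - \<alpha>) * ((x - s) powr (- \<alpha> - 1) - (x - s + (y - x)) powr (- \<alpha> - 1))"
    for s by (simp add: right_diff_distrib)
  have "\<alpha> / Gamma (1 - \<alpha>) * ((x - s) powr (- \<alpha> - 1) - (x - s + (y - x)) powr (- \<alpha> - 1))
     \<le> \<alpha> / Gamma (1 - \<alpha>) * ((x - u) powr (- \<alpha> - 1) - (x - u + (y - x)) powr (- \<alpha> - 1))"
    if "s \<in> {0..c}" "u \<in> {0..c}" "s \<le> u" for s u
    using that assms G by (intro mult_left_mono powr_increment_mono) auto
  then show "mono_on {0..c} ?g'"
    unfolding g' by (rule mono_onI)
  fix s assume s: "s \<in> {0..c}"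
  show "((\<lambda>s. omega (1 - \<alpha>) (x - s) - omega (1 - \<alpha>) (y - s)) has_real_derivative ?g' s) (at s)"
    using s assms by (intro DERIV_diff omega_has_derivative) auto
  have "(y - s) powr p < (x - s) powr p" if "p < 0" for p
    using s assms that by (intro powr_less_mono2_neg) auto
  then show "0 < omega (1 - \<alpha>) (x - s) - omega (1 - \<alpha>) (y - s)" "0 < ?g' s"
    using assms G by (simp_all add: omega_def divide_strict_right_mono)
qed

section \<open>The kernel functionals on the mesh\<close>

locale mesh =
  fixes t :: "nat \<Rightarrow> real"
  assumes t_0: "t 0 = 0"
    and t_less_Suc: "t k < t (Suc k)"
    and ratio_ge: "2 \<le> k \<Longrightarrow> R_star \<le> ratio t k"
begin

lemma t_strict_mono: "strict_mono t"
  using t_less_Suc by (simp add: strict_mono_Suc_iff)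

lemma t_less: "i < j \<Longrightarrow> t i < t j"
  using t_strict_mono by (simp add: strict_mono_less)

lemma t_le: "i \<le> j \<Longrightarrow> t i \<le> t j"
  using t_strict_mono by (simp add: strict_mono_less_eq)

lemma t_nonneg: "0 \<le> t k"
  using t_le[of 0 k] t_0 by simp

lemma t_pred_less: "1 \<le> k \<Longrightarrow> t (k - 1) < t k"
  by (rule t_less) simp

lemma ratio_pos: "2 \<le> k \<Longrightarrow> 0 < ratio t k"
  using ge_R_star_props ratio_ge by blast

lemma ratio_Suc: "1 \<le> k \<Longrightarrow> ratio t (k + 1) = (t (k + 1) - t k) / (t k - t (k - 1))"
  by (simp add: ratio_def tau_def)

lemma admissible_cell:
  assumes "admissible (t k) g"
  shows "continuous_on {t (k - 1)..t k} g" "mono_on {t (k - 1)..t k} g"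
proof -
  have sub: "{t (k - 1)..t k} \<subseteq> {0..t k}" using t_nonneg by auto
  show "continuous_on {t (k - 1)..t k} g"
    using admissible_imp_continuous_on[OF assms] sub by (rule continuous_on_subset)
  show "mono_on {t (k - 1)..t k} g"
    using admissible_imp_mono_on[OF assms] sub by (rule mono_on_subset)
qed

lemma skew_cell_pos:
  assumes "1 \<le> k" "admissible (t k) g"
  shows "0 < skew (t (k - 1)) (t k) g"
proof -
  obtain g' where g': "\<forall>s\<in>{0..t k}. 0 < g s \<and> 0 < g' s \<and> (g has_real_derivative g' s) (at s)"
    "mono_on {0..t k} g'"
    using assms unfolding admissible_def by blast
  have mem: "t (k - 1) \<in> {0..t k}" "t k \<in> {0..t k}"
    using t_nonneg t_pred_less[OF assms(1)] by auto
  have "g' (t (k - 1)) * (t k - t (k - 1)) / 6 \<le> skew (t (k - 1)) (t k) g"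
  proof (rule skew_bounds(1)[OF t_pred_less[OF assms(1)]])
    fix s assume "s \<in> {t (k - 1)..t k}"
    then have s: "s \<in> {0..t k}" "t (k - 1) \<le> s" "s \<le> t k"
      using t_nonneg[of "k - 1"] by auto
    show "(g has_real_derivative g' s) (at s)" using g' s by blast
    show "g' (t (k - 1)) \<le> g' s \<and> g' s \<le> g' (t k)"
      using mono_onD[OF g'(2)] s mem by blast
  qed
  moreover have "0 < g' (t (k - 1)) * (t k - t (k - 1)) / 6"
    using g' mem t_pred_less[OF assms(1)] by auto
  ultimately show ?thesis by linarith
qed

text \<open>The contribution of the cell before \<open>k\<close>. For \<open>k = 1\<close> there is
  no such cell, and \<open>ratio t 1 = 0\<close> would be a denominator.\<close>

definition carry :: "(real \<Rightarrow> real) \<Rightarrow> nat \<Rightarrow> real" where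
  "carry g k = (if k \<le> 1 then 0
     else skew (t (k - 2)) (t (k - 1)) g / (ratio t k * (1 + ratio t k)))"

text \<open>With \<open>level n\<close> for \<open>g\<close> and \<open>1 \<le> k < n\<close> this
  is \<open>kA t \<alpha> n k\<close>. Keeping \<open>g\<close> free lets the same bounds apply to a
  difference of levels.\<close>

definition kernel :: "(real \<Rightarrow> real) \<Rightarrow> nat \<Rightarrow> real" where
  "kernel g k = avg (t (k - 1)) (t k) g - skew (t (k - 1)) (t k) g / (1 + ratio t (k + 1)) + carry g k"

lemma carry_pos:
  assumes "2 \<le> k" "admissible (t (k - 1)) g"
  shows "0 < carry g k"
  using assms skew_cell_pos[of "k - 1" g] ratio_pos[of k]
  by (simp add: carry_def numeral_2_eq_2)

lemma carry_nonneg: "admissible (t (k - 1)) g \<Longrightarrow> 0 \<le> carry g k"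
  using carry_pos[of k g] by (cases "2 \<le> k") (auto simp: carry_def)

text \<open>
  The only use of the lower bound on the step ratios: with \<open>m\<close> the slope at \<open>t (k - 1)\<close>,
  convexity puts the average at least \<open>m \<tau>\<^sub>k / 2\<close> below the right endpoint value, while the
  skew moment of the preceding cell is at most \<open>m \<tau>\<^sub>k\<^sub>-\<^sub>1 / 6\<close>.
\<close>

lemma avg_plus_carry_le:
  assumes "1 \<le> k" "admissible (t k) g"
  shows "avg (t (k - 1)) (t k) g + carry g k \<le> g (t k)"
proof -
  obtain g' where g': "\<forall>s\<in>{0..t k}. 0 < g s \<and> 0 < g' s \<and> (g has_real_derivative g' s) (at s)"
    "mono_on {0..t k} g'"
    using assms unfolding admissible_def by blast
  define m where "m = g' (t (k - 1))"
  have mem: "t (k - 1) \<in> {0..t k}"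
    using t_nonneg t_pred_less[OF assms(1)] by auto
  have m: "0 < m" using g' mem by (simp add: m_def)
  have avg: "avg (t (k - 1)) (t k) g \<le> g (t k) - m * (t k - t (k - 1)) / 2"
  proof (rule avg_le_endpoint[OF t_pred_less[OF assms(1)]])
    fix s assume "s \<in> {t (k - 1)..t k}"
    then have s: "s \<in> {0..t k}" "t (k - 1) \<le> s" "s \<le> t k"
      using t_nonneg[of "k - 1"] by auto
    show "(g has_real_derivative g' s) (at s)" using g' s by blast
    show "m \<le> g' s"
      using mono_onD[OF g'(2)] s mem by (auto simp: m_def)
  qed
  have "carry g k \<le> m * (t k - t (k - 1)) / 2"
  proof (cases "k \<le> 1")
    case True
    then show ?thesis using m t_pred_less[OF assms(1)] by (simp add: carry_def)
  next
    case False
    define r where "r = ratio t k"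
    have lt: "t (k - 2) < t (k - 1)" using False by (intro t_less) auto
    have r: "0 < r" "1 / (r * (1 + r)) \<le> 3 * r"
      using ge_R_star_props[of r] ratio_ge[of k] False by (auto simp: r_def)
    have req: "r * (t (k - 1) - t (k - 2)) = t k - t (k - 1)"
      using ratio_Suc[of "k - 1"] False lt by (simp add: r_def numeral_2_eq_2)
    have skew: "skew (t (k - 2)) (t (k - 1)) g \<le> m * (t (k - 1) - t (k - 2)) / 6"
    proof (rule skew_bounds(2)[OF lt])
      fix s assume "s \<in> {t (k - 2)..t (k - 1)}"
      then have s: "s \<in> {0..t k}" "t (k - 2) \<le> s" "s \<le> t (k - 1)"
        using t_nonneg[of "k - 2"] t_pred_less[OF assms(1)] by auto
      show "(g has_real_derivative g' s) (at s)" using g' s by blast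
      show "0 \<le> g' s \<and> g' s \<le> m"
        using mono_onD[OF g'(2)] g'(1) s mem by (auto simp: m_def intro: less_imp_le)
    qed
    have "carry g k = 1 / (r * (1 + r)) * skew (t (k - 2)) (t (k - 1)) g"
      using False by (simp add: carry_def r_def)
    also have "\<dots> \<le> 1 / (r * (1 + r)) * (m * (t (k - 1) - t (k - 2)) / 6)"
      using skew r(1) by (intro mult_left_mono) auto
    also have "\<dots> \<le> 3 * r * (m * (t (k - 1) - t (k - 2)) / 6)"
      using r m lt by (intro mult_right_mono) auto
    also have "\<dots> = m * (r * (t (k - 1) - t (k - 2))) / 2" by simp
    finally show ?thesis by (simp only: req)
  qed
  with avg show ?thesis by linarith
qed

lemma kernel_le:
  assumes "1 \<le> k" "admissible (t k) g"
  shows "kernel g k \<le> g (t k)"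
proof -
  have "0 < skew (t (k - 1)) (t k) g / (1 + ratio t (k + 1))"
    using skew_cell_pos[OF assms] ratio_pos[of "k + 1"] assms(1) by (intro divide_pos_pos) auto
  then show ?thesis
    using avg_plus_carry_le[OF assms] by (simp add: kernel_def)
qed

text \<open>Here \<open>avg_minus_skew_ge\<close> applies with
  \<open>\<theta> = 1 / (1 + r)\<close>. The bound keeps \<open>carry\<close> because it makes
  \<open>kernel_less_Suc\<close> strict.\<close>

lemma kernel_ge:
  assumes "1 \<le> k" "admissible (t k) g"
  shows "g (t (k - 1)) + carry g k \<le> kernel g k"
proof -
  have "0 < ratio t (k + 1)" using ratio_pos[of "k + 1"] assms(1) by auto
  then show ?thesis
    using avg_minus_skew_ge[OF t_pred_less[OF assms(1)] admissible_cell[OF assms(2)],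
        of "1 / (1 + ratio t (k + 1))"]
    by (simp add: kernel_def)
qed

lemma kernel_pos:
  assumes "1 \<le> k" "admissible (t k) g"
  shows "0 < kernel g k"
proof -
  have "t (k - 1) \<in> {0..t k}" using t_nonneg t_pred_less[OF assms(1)] by auto
  then have "0 < g (t (k - 1))" using assms(2) unfolding admissible_def by blast
  moreover have "0 \<le> carry g k"
    using assms t_pred_less by (intro carry_nonneg) (auto intro: admissible_antimono less_imp_le)
  ultimately show ?thesis using kernel_ge[OF assms] by linarith
qed

text \<open>The value \<open>g (t k)\<close> separates the two kernels; \<open>carry\<close> is
  positive at \<open>k + 1\<close> since a preceding cell exists.\<close>

lemma kernel_less_Suc:
  assumes "1 \<le> k" "admissible (t (k + 1)) g"
  shows "kernel g k < kernel g (k + 1)"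
proof -
  have adm: "admissible (t k) g"
    using admissible_antimono[OF assms(2)] t_le by simp
  have "kernel g k \<le> g (t k)" using kernel_le[OF assms(1) adm] .
  also have "\<dots> < g (t k) + carry g (k + 1)"
    using carry_pos[of "k + 1" g] adm assms(1) by simp
  also have "\<dots> \<le> kernel g (k + 1)" using kernel_ge[of "k + 1" g] assms by simp
  finally show ?thesis .
qed

lemma carry_diff:
  assumes "admissible (t (k - 1)) f" "admissible (t (k - 1)) g"
  shows "carry (\<lambda>s. f s - g s) k = carry f k - carry g k"
  using skew_diff[of "t (k - 2)" "t (k - 1)" f g] admissible_cell(1)[OF assms(1)]
    admissible_cell(1)[OF assms(2)]
  by (simp add: carry_def diff_divide_distrib numeral_2_eq_2)

lemma kernel_diff:
  assumes "1 \<le> k" "admissible (t k) f" "admissible (t k) g"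
  shows "kernel (\<lambda>s. f s - g s) k = kernel f k - kernel g k"
proof -
  have "admissible (t (k - 1)) f" "admissible (t (k - 1)) g"
    using assms admissible_antimono t_le[of "k - 1" k] by (blast intro: diff_le_self)+
  then show ?thesis
    by (simp only: kernel_def carry_diff avg_diff skew_diff admissible_cell(1) assms(2,3))
      (simp add: diff_divide_distrib)
qed

end

section \<open>Monotonicity of the auxiliary kernels\<close>

locale caputo_mesh = mesh +
  fixes \<alpha> :: real
  assumes alpha_pos: "0 < \<alpha>" and alpha_less_1: "\<alpha> < 1"
begin

abbreviation level :: "nat \<Rightarrow> real \<Rightarrow> real" where
  "level n s \<equiv> omega (1 - \<alpha>) (t n - s)"

abbreviation level_diff :: "nat \<Rightarrow> real \<Rightarrow> real" where
  "level_diff n s \<equiv> level n s - level (n + 1) s"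

lemma ka_eq_avg: "ka t \<alpha> n k = avg (t (k - 1)) (t k) (level n)"
  by (simp add: ka_def avg_def tau_def)

lemma keta_eq_skew: "keta t \<alpha> n k = skew (t (k - 1)) (t k) (level n)"
  by (simp add: keta_def skew_def tau_def)

lemma admissible_level: "k < n \<Longrightarrow> admissible (t k) (level n)"
  using alpha_pos alpha_less_1 t_less by (intro admissible_omega)

lemma admissible_level_diff: "k < n \<Longrightarrow> admissible (t k) (level_diff n)"
  using alpha_pos alpha_less_1 t_less by (intro admissible_omega_diff) auto

lemma kA_off_diag: "1 \<le> k \<Longrightarrow> k < n \<Longrightarrow> kA t \<alpha> n k = kernel (level n) k"
  by (auto simp: kA_def khat_def kernel_def carry_def ka_eq_avg keta_eq_skew numeral_2_eq_2)

lemma kA_off_diag_diff: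
  "1 \<le> k \<Longrightarrow> k < n \<Longrightarrow> kA t \<alpha> n k - kA t \<alpha> (n + 1) k = kernel (level_diff n) k"
  by (simp add: kA_off_diag kernel_diff admissible_level)

text \<open>For \<open>n \<ge> 2\<close> this is an equality, as
  \<open>2 / (2 - \<alpha>) = 1 + \<alpha> / (2 - \<alpha>)\<close>; at \<open>n = 1\<close> the
  factor \<open>2 / (1 - \<alpha>)\<close> is larger. The doubling in \<open>kA\<close> also doubles
  \<open>carry\<close>.\<close>

lemma kA_diag_ge:
  assumes "1 \<le> n"
  shows "(1 + \<alpha> / (2 - \<alpha>)) * level n (t (n - 1)) + 2 * carry (level n) n \<le> kA t \<alpha> n n"
proof -
  let ?\<omega> = "level n (t (n - 1))"
  have \<omega>: "0 < ?\<omega>"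
    using alpha_less_1 t_pred_less[OF assms] by (intro omega_pos) auto
  have ka: "ka t \<alpha> n n = ?\<omega> / (1 - \<alpha>)"
    using avg_omega_diag[OF alpha_pos alpha_less_1 t_pred_less[OF assms]] by (simp add: ka_eq_avg)
  show ?thesis
  proof (cases "n = 1")
    case True
    have "(1 + \<alpha> / (2 - \<alpha>)) * ?\<omega> \<le> 2 / (1 - \<alpha>) * ?\<omega>"
      using \<omega> alpha_pos alpha_less_1 by (intro mult_right_mono) (auto simp: field_simps)
    then show ?thesis using True ka by (simp add: kA_def khat_def carry_def)
  next
    case False
    have "2 * ((1 - \<alpha>) / (2 - \<alpha>) * (?\<omega> / (1 - \<alpha>))) = (1 + \<alpha> / (2 - \<alpha>)) * ?\<omega>"
    proof -
      have "1 + \<alpha> / (2 - \<alpha>) = 2 / (2 - \<alpha>)" using alpha_less_1 by (simp add: field_simps)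
      then show ?thesis using alpha_less_1 by simp
    qed
    then show ?thesis
      using False assms ka
      by (simp add: kA_def khat_def carry_def keta_eq_skew numeral_2_eq_2 distrib_left)
  qed
qed

text \<open>Since \<open>level n\<close> is singular at \<open>t n\<close>,
  \<open>kernel_diff\<close> cannot reach this cell. The surplus
  \<open>\<alpha> / (2 - \<alpha>)\<close> in \<open>kA_diag_ge\<close> pays for the one in
  \<open>avg_minus_skew_omega_less\<close>, and the carries only help.\<close>

lemma kA_diag_diff_gt:
  assumes "1 \<le> n"
  shows "level_diff n (t (n - 1)) < kA t \<alpha> n n - kA t \<alpha> (n + 1) n"
proof -
  have adm: "admissible (t (n - 1)) (level n)" "admissible (t (n - 1)) (level (n + 1))"
    "admissible (t (n - 1)) (level_diff n)"
    using assms by (intro admissible_level admissible_level_diff; simp)+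
  have "avg (t (n - 1)) (t n) (level (n + 1))
      - skew (t (n - 1)) (t n) (level (n + 1)) / (1 + ratio t (n + 1))
      < level (n + 1) (t (n - 1)) + \<alpha> / (2 - \<alpha>) * level n (t (n - 1))"
    using avg_minus_skew_omega_less[OF alpha_pos alpha_less_1 t_pred_less[OF assms],
        of "t (n + 1)"] t_less[of n "n + 1"] by (simp only: ratio_Suc[OF assms])
  then have "kA t \<alpha> (n + 1) n < level (n + 1) (t (n - 1)) + \<alpha> / (2 - \<alpha>) * level n (t (n - 1))
      + carry (level (n + 1)) n"
    using assms by (simp add: kA_off_diag kernel_def)
  moreover have "0 \<le> carry (level n) n" "0 \<le> carry (level n) n - carry (level (n + 1)) n"
    using carry_nonneg[OF adm(1)] carry_nonneg[OF adm(3)] carry_diff[OF adm(1,2)] by auto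
  moreover have "(1 + \<alpha> / (2 - \<alpha>)) * level n (t (n - 1))
      = level n (t (n - 1)) + \<alpha> / (2 - \<alpha>) * level n (t (n - 1))"
    by (simp add: distrib_right)
  ultimately show ?thesis
    using kA_diag_ge[OF assms] by linarith
qed

lemma kA_pos: "1 \<le> k \<Longrightarrow> k < n \<Longrightarrow> 0 < kA t \<alpha> n k"
  by (simp add: kA_off_diag kernel_pos admissible_level)

lemma kA_less_Suc:
  assumes "1 \<le> k" "k < n"
  shows "kA t \<alpha> n k < kA t \<alpha> n (k + 1)"
proof (cases "k + 1 = n")
  \<comment> \<open>Next to the diagonal, strictness comes from the factor
    \<open>1 + \<alpha> / (2 - \<alpha>)\<close>.\<close>
  case True
  have \<omega>: "0 < level n (t k)"
    using alpha_less_1 t_less[OF assms(2)] by (intro omega_pos) auto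
  have "kA t \<alpha> n k \<le> level n (t k)"
    using assms kernel_le[OF assms(1) admissible_level[OF assms(2)]] by (simp add: kA_off_diag)
  also have "\<dots> < (1 + \<alpha> / (2 - \<alpha>)) * level n (t k)"
    using \<omega> alpha_pos alpha_less_1 by simp
  also have "\<dots> \<le> kA t \<alpha> n n"
    using kA_diag_ge[of n] carry_nonneg[of n "level n"] admissible_level[of k n] assms True
    by auto
  finally show ?thesis using True by simp
next
  case False
  then show ?thesis
    using assms by (simp add: kA_off_diag kernel_less_Suc[simplified] admissible_level)
qed

lemma kA_level_decreasing:
  assumes "1 \<le> k" "k \<le> n"
  shows "kA t \<alpha> (n + 1) k < kA t \<alpha> n k"
proof (cases "k = n")
  case True
  have "0 < level_diff n (t (n - 1))"
    using admissible_level_diff[of "n - 1" n] assms t_nonneg unfolding admissible_def by auto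
  then show ?thesis using kA_diag_diff_gt[of n] assms True by simp
next
  case False
  then show ?thesis
    using assms kA_off_diag_diff[of k n] kernel_pos[of k "level_diff n"]
      admissible_level_diff[of k n] by simp
qed

text \<open>Rearranged, the gap between levels \<open>n\<close> and \<open>n + 1\<close> grows with
  \<open>k\<close>. If \<open>k + 1 = n\<close>, the value \<open>level_diff n (t k)\<close>
  separates the two gaps.\<close>

lemma kA_increment_level_decreasing:
  assumes "1 \<le> k" "k < n"
  shows "kA t \<alpha> (n + 1) (k + 1) - kA t \<alpha> (n + 1) k < kA t \<alpha> n (k + 1) - kA t \<alpha> n k"
proof -
  have "kernel (level_diff n) k < kA t \<alpha> n (k + 1) - kA t \<alpha> (n + 1) (k + 1)"
  proof (cases "k + 1 = n")
    case True
    then show ?thesis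
      using kernel_le[OF assms(1) admissible_level_diff[OF assms(2)]] kA_diag_diff_gt[of n] by auto
  next
    case False
    then show ?thesis
      using assms kA_off_diag_diff[of "k + 1" n] kernel_less_Suc[of k "level_diff n"]
        admissible_level_diff[of "k + 1" n] by simp
  qed
  then show ?thesis using kA_off_diag_diff[OF assms] by linarith
qed

end

section \<open>Summation by parts and the energy inequality\<close>

text \<open>Passing to \<open>Suc n\<close> adds \<open>d (Suc n)\<close> to every tail, and the
  weights of these additions telescope.\<close>

lemma sum_by_parts_tails:
  fixes A d :: "nat \<Rightarrow> real"
  assumes "1 \<le> n"
  shows "(\<Sum>k = 1..n. A k * d k)
    = (\<Sum>j = 1..n - 1. (A (j + 1) - A j) * (\<Sum>l = j + 1..n. d l)) + A 1 * (\<Sum>l = 1..n. d l)"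
  using assms
proof (induction n rule: dec_induct)
  case (step n)
  have "(\<Sum>j = 1..n. (A (j + 1) - A j) * (\<Sum>l = j + 1..Suc n. d l))
      = (\<Sum>j = 1..n. (A (j + 1) - A j) * (\<Sum>l = j + 1..n. d l) + (A (j + 1) - A j) * d (Suc n))"
    by (intro sum.cong) (auto simp: distrib_left)
  also have "\<dots> = (\<Sum>j = 1..n. (A (j + 1) - A j) * (\<Sum>l = j + 1..n. d l))
      + (\<Sum>j = 1..n. A (Suc j) - A j) * d (Suc n)"
    by (simp add: sum.distrib sum_distrib_right)
  also have "(\<Sum>j = 1..n. A (Suc j) - A j) = A (Suc n) - A 1"
    using step.hyps by (subst sum_Suc_diff) auto
  also have "(\<Sum>j = 1..n. (A (j + 1) - A j) * (\<Sum>l = j + 1..n. d l))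
      = (\<Sum>j = 1..n - 1. (A (j + 1) - A j) * (\<Sum>l = j + 1..n. d l))"
    using step.hyps by (cases n) auto
  finally show ?case
    using step by (simp add: algebra_simps)
qed simp

text \<open>The bracket of the energy inequality. The weights \<open>A\<close> are independent of
  \<open>n\<close>, so those of one level can meet the tail sums of the previous one.\<close>

definition tail_energy :: "(nat \<Rightarrow> real) \<Rightarrow> (nat \<Rightarrow> real) \<Rightarrow> nat \<Rightarrow> real" where
  "tail_energy A d n = (\<Sum>j = 1..n - 1. (A (j + 1) - A j) * (\<Sum>l = j + 1..n. d l)\<^sup>2)
     + A 1 * (\<Sum>l = 1..n. d l)\<^sup>2"

text \<open>
  With \<open>S j\<close> and \<open>T j\<close> the tail sums from \<open>j + 1\<close> up to \<open>n + 1\<close> and \<open>n\<close>, this sums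
  \<open>2 d (n + 1) S j = (S j)\<^sup>2 - (T j)\<^sup>2 + (d (n + 1))\<^sup>2\<close> against the increments of \<open>A\<close>.
\<close>

lemma quadratic_form_eq_tail_energy:
  fixes A d :: "nat \<Rightarrow> real"
  assumes "1 \<le> n"
  shows "2 * (d (Suc n) * (\<Sum>k = 1..Suc n. A k * d k)) - A (Suc n) * (d (Suc n))\<^sup>2
    = tail_energy A d (Suc n) - tail_energy A d n"
proof -
  define D where "D = d (Suc n)"
  define S where "S j = (\<Sum>l = j + 1..Suc n. d l)" for j
  define T where "T j = (\<Sum>l = j + 1..n. d l)" for j
  define B where "B j = A (j + 1) - A j" for j
  have ST: "S j = T j + D" if "j \<le> n" for j using that by (simp add: S_def T_def D_def)
  have sq: "2 * (D * S j) = (S j)\<^sup>2 - (T j)\<^sup>2 + D\<^sup>2" if "j \<le> n" for j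
    using ST[OF that] by (simp add: power2_eq_square algebra_simps)
  have tel: "(\<Sum>j = 1..n. B j) = A (Suc n) - A 1"
    unfolding B_def using assms sum_Suc_diff[of 1 n A] by simp
  have "2 * (D * (\<Sum>k = 1..Suc n. A k * d k)) = (\<Sum>j = 1..n. B j * (2 * (D * S j))) + A 1 * (2 * (D * S 0))"
    using sum_by_parts_tails[of "Suc n" A d]
    by (simp add: B_def S_def distrib_left sum_distrib_left ac_simps)
  also have "(\<Sum>j = 1..n. B j * (2 * (D * S j))) = (\<Sum>j = 1..n. B j * (S j)\<^sup>2 - B j * (T j)\<^sup>2 + B j * D\<^sup>2)"
    by (intro sum.cong refl, subst sq) (simp_all add: algebra_simps)
  also have "\<dots> = (\<Sum>j = 1..n. B j * (S j)\<^sup>2) - (\<Sum>j = 1..n. B j * (T j)\<^sup>2) + (A (Suc n) - A 1) * D\<^sup>2"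
    by (simp only: sum.distrib sum_subtractf tel flip: sum_distrib_right)
  \<comment> \<open>The term \<open>j = n\<close> drops out because \<open>T n\<close> is an empty
    sum.\<close>
  also have "(\<Sum>j = 1..n. B j * (T j)\<^sup>2) = (\<Sum>j = 1..n - 1. B j * (T j)\<^sup>2)"
    using assms by (cases n) (auto simp: T_def)
  also have "A 1 * (2 * (D * S 0)) = A 1 * (S 0)\<^sup>2 - A 1 * (T 0)\<^sup>2 + A 1 * D\<^sup>2"
    by (subst sq) (simp_all add: algebra_simps)
  finally show ?thesis
    by (simp add: tail_energy_def B_def S_def T_def D_def algebra_simps)
qed

text \<open>Squares are nonnegative, so comparing \<open>A 1\<close> and the increments suffices;
  (b) at \<open>k = 1\<close> and (c) supply this for consecutive levels.\<close>

lemma tail_energy_mono: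
  fixes A B d :: "nat \<Rightarrow> real"
  assumes "A 1 \<le> B 1" "\<And>j. 1 \<le> j \<Longrightarrow> j < n \<Longrightarrow> A (j + 1) - A j \<le> B (j + 1) - B j"
  shows "tail_energy A d n \<le> tail_energy B d n"
  unfolding tail_energy_def using assms
  by (intro add_mono sum_mono mult_right_mono) auto

theorem theorem2p1:
  fixes \<alpha> :: real and t :: "nat \<Rightarrow> real"
  assumes "0 < \<alpha>" and "\<alpha> < 1"
    and "t 0 = 0" and "\<And>k. t k < t (Suc k)"
    and "\<And>k. k \<ge> 2 \<Longrightarrow> ratio t k \<ge> R_star"
  shows "(\<forall>n k. 2 \<le> n \<and> 1 \<le> k \<and> k \<le> n - 1 \<longrightarrow>
            kA t \<alpha> n (k + 1) > kA t \<alpha> n k \<and> kA t \<alpha> n k > 0)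
       \<and> (\<forall>n k. 2 \<le> n \<and> 1 \<le> k \<and> k \<le> n - 1 \<longrightarrow>
            kA t \<alpha> (n - 1) k > kA t \<alpha> n k)
       \<and> (\<forall>n k. 3 \<le> n \<and> 1 \<le> k \<and> k \<le> n - 2 \<longrightarrow>
            kA t \<alpha> (n - 1) (k + 1) - kA t \<alpha> (n - 1) k
              > kA t \<alpha> n (k + 1) - kA t \<alpha> n k)
       \<and> (\<forall>(v :: nat \<Rightarrow> real) n. 2 \<le> n \<longrightarrow>
            nabla v n * (\<Sum>k = 1..n. khat t \<alpha> n k * nabla v k)
            \<ge> 1 / 2 * ((\<Sum>j = 1..n - 1. (kA t \<alpha> n (j + 1) - kA t \<alpha> n j)
                              * (\<Sum>l = j + 1..n. nabla v l)\<^sup>2)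
                        + kA t \<alpha> n 1 * (\<Sum>l = 1..n. nabla v l)\<^sup>2)
              - 1 / 2 * ((\<Sum>j = 1..n - 2. (kA t \<alpha> (n - 1) (j + 1) - kA t \<alpha> (n - 1) j)
                              * (\<Sum>l = j + 1..n - 1. nabla v l)\<^sup>2)
                        + kA t \<alpha> (n - 1) 1 * (\<Sum>l = 1..n - 1. nabla v l)\<^sup>2))"
proof -
  interpret caputo_mesh t \<alpha>
    using assms by unfold_locales auto
  have b: "kA t \<alpha> n k < kA t \<alpha> (n - 1) k" if "2 \<le> n" "1 \<le> k" "k \<le> n - 1" for n k
    using kA_level_decreasing[of k "n - 1"] that by simp
  have c: "kA t \<alpha> n (k + 1) - kA t \<alpha> n k < kA t \<alpha> (n - 1) (k + 1) - kA t \<alpha> (n - 1) k"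
    if "3 \<le> n" "1 \<le> k" "k \<le> n - 2" for n k
    using kA_increment_level_decreasing[of k "n - 1"] that by simp
  have energy: "nabla v n * (\<Sum>k = 1..n. khat t \<alpha> n k * nabla v k)
      \<ge> 1 / 2 * tail_energy (kA t \<alpha> n) (nabla v) n
        - 1 / 2 * tail_energy (kA t \<alpha> (n - 1)) (nabla v) (n - 1)" if n: "2 \<le> n" for v n
  proof -
    obtain m where m: "n = Suc m" "1 \<le> m" using n by (cases n) auto
    have "(\<Sum>k = 1..m. khat t \<alpha> n k * nabla v k) = (\<Sum>k = 1..m. kA t \<alpha> n k * nabla v k)"
      by (intro sum.cong) (auto simp: kA_def m(1))
    \<comment> \<open>The doubled diagonal of \<open>kA\<close> adds
      \<open>kA t \<alpha> n n * (nabla v n)\<^sup>2\<close>, which is subtracted again.\<close>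
    then have "2 * (nabla v n * (\<Sum>k = 1..n. khat t \<alpha> n k * nabla v k))
        = 2 * (nabla v n * (\<Sum>k = 1..n. kA t \<alpha> n k * nabla v k)) - kA t \<alpha> n n * (nabla v n)\<^sup>2"
      by (simp add: m(1) kA_def power2_eq_square algebra_simps)
    also have "\<dots> = tail_energy (kA t \<alpha> n) (nabla v) n - tail_energy (kA t \<alpha> n) (nabla v) m"
      using quadratic_form_eq_tail_energy[OF m(2), of "nabla v" "kA t \<alpha> n"] by (simp add: m(1))
    also have "\<dots> \<ge> tail_energy (kA t \<alpha> n) (nabla v) n - tail_energy (kA t \<alpha> m) (nabla v) m"
      using b[OF n, of 1] c[of n] m
      by (intro diff_left_mono tail_energy_mono) (auto intro: less_imp_le)
    finally show ?thesis using m(1) by simp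
  qed
  \<comment> \<open>At \<open>n - 1\<close>, \<open>tail_energy\<close> sums up to
    \<open>n - 1 - 1\<close>, where the claim has \<open>n - 2\<close>.\<close>
  have "n - 1 - 1 = n - 2" for n :: nat by simp
  then show ?thesis
    using kA_pos kA_less_Suc b c energy[unfolded tail_energy_def] by auto
qed

end
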